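(* The axiomatic rank of (the variety of monoids $\mathbb{V}(\mathrm{mSt})$ generated by) the meet-stalactic monoid $\mathrm{mSt}$ is $4$.
   Context: With $\mathbb{N}=\{1,2,\dots\}$, the meet-stalactic monoid is $\mathrm{mSt}=\mathbb{N}^*/{\equiv_{\mathrm{mSt}}}$, where $u\equiv_{\mathrm{mSt}}v$ iff every letter occurs the same number of times in $u$ and $v$, the order of the first occurrences of the letters (reading left to right) is the same in $u$ and $v$, and the order of the last occurrences of the letters (reading left to right) is the same in $u$ and $v$. Identities are formal equalities $u\approx v$ of words over an alphabet of variables $\mathcal{X}$ (taken countably infinite); a monoid $M$ satisfies $u\approx v$ if $\psi(u)=\psi(v)$ for every monoid morphism $\psi:\mathcal{X}^*\to M$ (so variables may be sent to the identity element). The equational theory of $\mathbb{V}(M)$ is the set of identities satisfied by $M$. An equational basis of a variety is a subset $\mathcal{B}$ of its equational theory such that every identity of the equational theory lies in the fully invariant congruence on $\mathcal{X}^*$ generated by $\mathcal{B}$. The axiomatic rank of a variety is the least natural number $r$ such that the variety admits an equational basis in which the number of distinct variables occurring in each identity does not exceed $r$. *)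

theory Defs
  imports "HOL-Algebra.Group" "HOL-Library.Extended_Nat"
begin

definition free_monoid :: "'a set \<Rightarrow> 'a list monoid" where
  "free_monoid A = \<lparr>carrier = lists A, mult = (@), one = []\<rparr>"

text \<open>The library's \<open>hom\<close> only requires compatibility with multiplication.\<close>

definition monoid_hom ::
    "('a, 'c) monoid_scheme \<Rightarrow> ('b, 'd) monoid_scheme \<Rightarrow> ('a \<Rightarrow> 'b) set" where
  "monoid_hom M N = {h \<in> hom M N. h \<one>\<^bsub>M\<^esub> = \<one>\<^bsub>N\<^esub>}"

definition monoid_congruence :: "('a, 'c) monoid_scheme \<Rightarrow> 'a rel \<Rightarrow> bool" where
  "monoid_congruence M R \<longleftrightarrow> equiv (carrier M) R \<and>
     (\<forall>a b c d. (a, b) \<in> R \<longrightarrow> (c, d) \<in> R \<longrightarrow> (a \<otimes>\<^bsub>M\<^esub> c, b \<otimes>\<^bsub>M\<^esub> d) \<in> R)"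

text \<open>When \<open>R\<close> is a congruence, all the classes in the union below coincide.\<close>

definition quotient_monoid :: "('a, 'c) monoid_scheme \<Rightarrow> 'a rel \<Rightarrow> 'a set monoid" where
  "quotient_monoid M R =
     \<lparr>carrier = carrier M // R,
      mult = (\<lambda>A B. \<Union>a\<in>A. \<Union>b\<in>B. R `` {a \<otimes>\<^bsub>M\<^esub> b}),
      one = R `` {\<one>\<^bsub>M\<^esub>}\<rparr>"


section \<open>The meet-stalactic monoid\<close>

text \<open>
  The letters of a word, listed in the order of their first (respectively last) occurrences.
  Note that \<open>remdups\<close> keeps the last occurrence of every letter.
\<close>

definition first_occurrences :: "'a list \<Rightarrow> 'a list" where
  "first_occurrences w = rev (remdups (rev w))"

definition last_occurrences :: "'a list \<Rightarrow> 'a list" where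
  "last_occurrences w = remdups w"

definition mSt_rel :: "nat list rel" where
  "mSt_rel = {(u, v). u \<in> lists {1..} \<and> v \<in> lists {1..} \<and>
     (\<forall>a. count_list u a = count_list v a) \<and>
     first_occurrences u = first_occurrences v \<and>
     last_occurrences u = last_occurrences v}"

definition mSt :: "nat list set monoid" where
  "mSt = quotient_monoid (free_monoid {1..}) mSt_rel"

lemma remdups_append_cong:
  assumes "remdups a = remdups b" "remdups c = remdups d"
  shows "remdups (a @ c) = remdups (b @ d)"
proof -
  have *: "remdups (xs @ ys) = filter (\<lambda>x. x \<notin> set ys) (remdups xs) @ remdups ys"
    for xs ys :: "'a list"
    by (induction xs) auto
  have "set c = set d"
    using assms(2) by (metis set_remdups)
  then show ?thesis
    by (simp add: * assms)
qed

lemma mSt_congruence: "monoid_congruence (free_monoid {1..}) mSt_rel"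
  unfolding monoid_congruence_def
proof (intro conjI allI impI)
  show "equiv (carrier (free_monoid {1..})) mSt_rel"
    by (auto simp: free_monoid_def mSt_rel_def equiv_def refl_on_def sym_def trans_def)
next
  fix a b c d
  assume "(a, b) \<in> mSt_rel" "(c, d) \<in> mSt_rel"
  then show "(a \<otimes>\<^bsub>free_monoid {1..}\<^esub> c, b \<otimes>\<^bsub>free_monoid {1..}\<^esub> d) \<in> mSt_rel"
    by (auto simp: free_monoid_def mSt_rel_def first_occurrences_def last_occurrences_def
        intro: remdups_append_cong)
qed


section \<open>Identities, equational bases and axiomatic rank\<close>

text \<open>The variables are the natural numbers.\<close>

type_synonym identity = "nat list \<times> nat list"

abbreviation words :: "nat list monoid" where
  "words \<equiv> free_monoid UNIV"

definition satisfies :: "('a, 'c) monoid_scheme \<Rightarrow> identity \<Rightarrow> bool" where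
  "satisfies M e \<longleftrightarrow> (\<forall>\<psi> \<in> monoid_hom words M. \<psi> (fst e) = \<psi> (snd e))"

text \<open>
  A variety is represented by a generating monoid \<open>M\<close>; the identities holding throughout
  \<open>\<V>(M)\<close> are exactly those satisfied by \<open>M\<close>.
\<close>

definition equational_theory :: "('a, 'c) monoid_scheme \<Rightarrow> identity set" where
  "equational_theory M = {e. satisfies M e}"

definition fully_invariant_congruence :: "identity set \<Rightarrow> bool" where
  "fully_invariant_congruence R \<longleftrightarrow> monoid_congruence words R \<and>
     (\<forall>\<phi> \<in> monoid_hom words words. \<forall>(u, v) \<in> R. (\<phi> u, \<phi> v) \<in> R)"

definition generated_fully_invariant_congruence :: "identity set \<Rightarrow> identity set" where
  "generated_fully_invariant_congruence B =
     \<Inter> {R. fully_invariant_congruence R \<and> B \<subseteq> R}"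

definition equational_basis :: "('a, 'c) monoid_scheme \<Rightarrow> identity set \<Rightarrow> bool" where
  "equational_basis M B \<longleftrightarrow> B \<subseteq> equational_theory M \<and>
     equational_theory M \<subseteq> generated_fully_invariant_congruence B"

definition variables :: "identity \<Rightarrow> nat set" where
  "variables e = set (fst e) \<union> set (snd e)"

text \<open>
  The rank is the least admissible natural number; the infimum is taken in \<open>enat\<close> so that
  it is \<open>\<infinity>\<close> when there is no admissible number.
\<close>

definition axiomatic_rank :: "('a, 'c) monoid_scheme \<Rightarrow> enat" where
  "axiomatic_rank M =
     Inf {enat r |r. \<exists>B. equational_basis M B \<and> (\<forall>e \<in> B. card (variables e) \<le> r)}"

end

theory Submission
  imports Defs "HOL-Library.Multiset"
begin

text \<open>
  Substituting words for letters shows that an identity \<open>u \<approx> v\<close> holds in the monoid iff \<open>u\<close> and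
  \<open>v\<close> are themselves stalactic-equivalent. Such words are connected by transpositions of adjacent
  letters \<open>x, y\<close> of which at least one has occurred before, and at least one occurs again later
  (bring the first letter of \<open>u\<close> to the front of \<open>v\<close> and induct). These transpositions are the
  consequences of \<open>xsxytx \<approx> xsyxtx\<close> and \<open>xsyxty \<approx> xsxyty\<close>, so the rank is at most \<open>4\<close>.

  Conversely, the class of \<open>xsyxty\<close> consists of this word and \<open>xsxyty\<close> only. If \<open>a \<phi>(p) b\<close> and
  \<open>a \<phi>(q) b\<close> are these two words, for an identity \<open>p \<approx> q\<close> of the theory, then comparing the orders
  of the first occurrences in \<open>p\<close> and \<open>q\<close> from the left forces variables with images \<open>x\<close> and \<open>s\<close>;
  dually, variables with images \<open>y\<close> and \<open>t\<close> exist. So \<open>p\<close> has at least four variables.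
\<close>

section \<open>Stalactic equivalence\<close>

lemma remdups_append_filter:
  "remdups (xs @ ys) = filter (\<lambda>x. x \<notin> set ys) (remdups xs) @ remdups ys"
  by (induction xs) auto

text \<open>A non-last occurrence of \<open>x\<close> contributes a factor \<open>f x\<close> whose
  letters all recur in a later copy, so dropping it loses no last occurrence.\<close>

lemma remdups_concat_map_remdups:
  "remdups (concat (map f (remdups u))) = remdups (concat (map f u))"
proof (induction u)
  case (Cons x u)
  have "filter (\<lambda>a. \<forall>b\<in>set u. a \<notin> set (f b)) (remdups (f x)) = []" if "x \<in> set u"
    using that by (auto simp: filter_empty_conv)
  with Cons show ?case
    by (auto simp: remdups_append_filter)
qed simp

lemma remdups_map_inj: "inj f \<Longrightarrow> remdups (map f xs) = map f (remdups xs)"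
  by (induction xs) (auto simp: inj_image_mem_iff)

lemma first_occurrences_Cons:
  "first_occurrences (x # xs) = x # filter (\<lambda>a. a \<noteq> x) (first_occurrences xs)"
  by (simp add: first_occurrences_def remdups_append_filter rev_filter)

lemma first_occurrences_append:
  "first_occurrences (xs @ ys) =
     first_occurrences xs @ filter (\<lambda>a. a \<notin> set xs) (first_occurrences ys)"
  by (simp add: first_occurrences_def remdups_append_filter rev_filter)

lemma set_first_occurrences [simp]: "set (first_occurrences xs) = set xs"
  by (simp add: first_occurrences_def)

lemma first_occurrences_filter:
  "first_occurrences (filter P xs) = filter P (first_occurrences xs)"
  by (simp add: first_occurrences_def rev_filter[symmetric] remdups_filter[symmetric])

lemma first_occurrences_Nil [simp]: "first_occurrences [] = []"
  by (simp add: first_occurrences_def)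

lemma first_occurrences_eq_Nil_iff [simp]: "first_occurrences xs = [] \<longleftrightarrow> xs = []"
  by (simp add: first_occurrences_def)

definition stalactic_equiv :: "'a list \<Rightarrow> 'a list \<Rightarrow> bool" where
  "stalactic_equiv u v \<longleftrightarrow> mset u = mset v \<and>
     first_occurrences u = first_occurrences v \<and> last_occurrences u = last_occurrences v"

lemma stalactic_equiv_sym: "stalactic_equiv u v \<Longrightarrow> stalactic_equiv v u"
  by (simp add: stalactic_equiv_def)

lemma stalactic_equiv_append:
  assumes "stalactic_equiv a b" "stalactic_equiv c d"
  shows "stalactic_equiv (a @ c) (b @ d)"
  using assms
  by (auto simp: stalactic_equiv_def first_occurrences_def last_occurrences_def
      intro: remdups_append_cong)

lemma stalactic_equiv_concat_map:
  assumes "stalactic_equiv u v"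
  shows "stalactic_equiv (concat (map f u)) (concat (map f v))"
proof -
  have m: "mset (concat (map f w)) = (\<Sum>x\<in>#mset w. mset (f x))" for w
    by (induction w) auto
  have r: "rev (concat (map f w)) = concat (map (rev \<circ> f) (rev w))" for w
    by (simp add: rev_concat rev_map)
  have "remdups (concat (map f u)) = remdups (concat (map f v))"
    using assms unfolding stalactic_equiv_def last_occurrences_def
    by (metis remdups_concat_map_remdups)
  moreover have "remdups (rev (concat (map f u))) = remdups (rev (concat (map f v)))"
    using assms unfolding stalactic_equiv_def first_occurrences_def r
    by (metis remdups_concat_map_remdups rev_rev_ident)
  ultimately show ?thesis
    using assms by (simp add: stalactic_equiv_def m first_occurrences_def last_occurrences_def)
qed

lemma stalactic_equiv_map_inj:
  assumes "inj f"
  shows "stalactic_equiv (map f u) (map f v) \<longleftrightarrow> stalactic_equiv u v"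
proof -
  have "mset (map f u) = mset (map f v) \<longleftrightarrow> mset u = mset v"
    using multiset.inj_map[OF assms] by (auto dest: injD)
  then show ?thesis
    using assms
    by (simp add: stalactic_equiv_def first_occurrences_def last_occurrences_def
        remdups_map_inj inj_map_eq_map rev_map)
qed

lemma mSt_rel_iff:
  "(u, v) \<in> mSt_rel \<longleftrightarrow> u \<in> lists {1..} \<and> v \<in> lists {1..} \<and> stalactic_equiv u v"
  by (auto simp: mSt_rel_def stalactic_equiv_def multiset_eq_iff count_mset)


section \<open>The equational theory\<close>

lemma monoid_hom_words_iff:
  "\<psi> \<in> monoid_hom words M \<longleftrightarrow> (\<forall>u. \<psi> u \<in> carrier M) \<and>
     (\<forall>u v. \<psi> (u @ v) = \<psi> u \<otimes>\<^bsub>M\<^esub> \<psi> v) \<and> \<psi> [] = \<one>\<^bsub>M\<^esub>"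
  by (auto simp: monoid_hom_def hom_def free_monoid_def)

lemma monoid_hom_words_words_iff:
  "\<psi> \<in> monoid_hom words words \<longleftrightarrow> (\<exists>f. \<psi> = (\<lambda>u. concat (map f u)))"
proof
  assume *: "\<psi> \<in> monoid_hom words words"
  then have append: "\<psi> (u @ v) = \<psi> u @ \<psi> v" for u v
    unfolding monoid_hom_words_iff by (simp add: free_monoid_def)
  have "\<psi> u = concat (map (\<lambda>x. \<psi> [x]) u)" for u
  proof (induction u)
    case (Cons x u)
    then show ?case using append[of "[x]" u] by simp
  qed (use append[of "[]" "[]"] in simp)
  then show "\<exists>f. \<psi> = (\<lambda>u. concat (map f u))" by blast
next
  assume "\<exists>f. \<psi> = (\<lambda>u. concat (map f u))"
  then show "\<psi> \<in> monoid_hom words words"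
    unfolding monoid_hom_words_iff by (auto simp: free_monoid_def)
qed

lemma mSt_rel_equiv: "equiv (lists {1..}) mSt_rel"
  using mSt_congruence by (simp add: monoid_congruence_def free_monoid_def)

lemma mSt_class_mult:
  assumes "u \<in> lists {1..}" "v \<in> lists {1..}"
  shows "mSt_rel `` {u} \<otimes>\<^bsub>mSt\<^esub> mSt_rel `` {v} = mSt_rel `` {u @ v}"
proof -
  have "mSt_rel `` {a @ b} = mSt_rel `` {u @ v}" if "a \<in> mSt_rel `` {u}" "b \<in> mSt_rel `` {v}" for a b
    using that equiv_class_eq[OF mSt_rel_equiv, of "u @ v" "a @ b"]
    by (auto simp: mSt_rel_iff stalactic_equiv_append)
  then have "(\<Union>a\<in>mSt_rel `` {u}. \<Union>b\<in>mSt_rel `` {v}. mSt_rel `` {a @ b}) =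
      (\<Union>a\<in>mSt_rel `` {u}. \<Union>b\<in>mSt_rel `` {v}. mSt_rel `` {u @ v})"
    by (intro SUP_cong refl)
  \<comment> \<open>A union of copies of one class equals that class only over nonempty index
    sets.\<close>
  moreover have "u \<in> mSt_rel `` {u}" "v \<in> mSt_rel `` {v}"
    using assms by (auto simp: mSt_rel_iff stalactic_equiv_def)
  then have "(\<Union>a\<in>mSt_rel `` {u}. \<Union>b\<in>mSt_rel `` {v}. mSt_rel `` {u @ v}) = mSt_rel `` {u @ v}"
    by blast
  ultimately show ?thesis
    by (simp only: mSt_def quotient_monoid_def free_monoid_def) simp
qed

lemma mSt_one: "\<one>\<^bsub>mSt\<^esub> = mSt_rel `` {[]}"
  by (simp add: mSt_def quotient_monoid_def free_monoid_def)

lemma mSt_carrier: "carrier mSt = lists {1..} // mSt_rel"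
  by (simp add: mSt_def quotient_monoid_def free_monoid_def)

lemma concat_map_in_lists: "(\<And>x. f x \<in> lists A) \<Longrightarrow> concat (map f u) \<in> lists A"
  by (induction u) auto

lemma monoid_hom_words_mSt_iff:
  "\<psi> \<in> monoid_hom words mSt \<longleftrightarrow>
     (\<exists>f. (\<forall>x. f x \<in> lists {1..}) \<and> \<psi> = (\<lambda>u. mSt_rel `` {concat (map f u)}))"
proof
  assume *: "\<psi> \<in> monoid_hom words mSt"
  have "\<exists>w. w \<in> lists {1..} \<and> \<psi> [x] = mSt_rel `` {w}" for x
    using * by (metis monoid_hom_words_iff mSt_carrier quotientE)
  then obtain f where f: "\<And>x. f x \<in> lists {1..}" "\<And>x. \<psi> [x] = mSt_rel `` {f x}"
    by metis
  have "\<psi> u = mSt_rel `` {concat (map f u)}" for u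
  proof (induction u)
    case Nil
    show ?case using * by (simp add: monoid_hom_words_iff mSt_one)
  next
    case (Cons x u)
    have "\<psi> ([x] @ u) = \<psi> [x] \<otimes>\<^bsub>mSt\<^esub> \<psi> u"
      using * unfolding monoid_hom_words_iff by blast
    then show ?case
      using f by (simp add: Cons mSt_class_mult concat_map_in_lists)
  qed
  with f(1) show "\<exists>f. (\<forall>x. f x \<in> lists {1..}) \<and> \<psi> = (\<lambda>u. mSt_rel `` {concat (map f u)})"
    by blast
next
  assume "\<exists>f. (\<forall>x. f x \<in> lists {1..}) \<and> \<psi> = (\<lambda>u. mSt_rel `` {concat (map f u)})"
  then obtain f where f: "\<And>x. f x \<in> lists {1..}"
    and \<psi>: "\<psi> = (\<lambda>u. mSt_rel `` {concat (map f u)})"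
    by blast
  have "concat (map f u) \<in> lists {1..}" for u
    using f by (rule concat_map_in_lists)
  then show "\<psi> \<in> monoid_hom words mSt"
    by (simp add: monoid_hom_words_iff mSt_one mSt_carrier mSt_class_mult quotientI \<psi>
        del: in_lists_conv_set)
qed

lemma equational_theory_mSt: "equational_theory mSt = {(u, v). stalactic_equiv u v}"
proof -
  have "stalactic_equiv u v" if "(u, v) \<in> equational_theory mSt" for u v
  proof -
    \<comment> \<open>Variables include 0 while letters start at 1; \<open>Suc\<close> embeds the
      former injectively into the latter.\<close>
    have h: "(\<lambda>u. mSt_rel `` {concat (map (\<lambda>x. [Suc x]) u)}) \<in> monoid_hom words mSt"
      unfolding monoid_hom_words_mSt_iff by (intro exI[of _ "\<lambda>x. [Suc x]"]) auto
    from that have "mSt_rel `` {map Suc u} = mSt_rel `` {map Suc v}"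
      by (auto simp: equational_theory_def satisfies_def dest!: bspec[OF _ h])
    moreover have "(map Suc v, map Suc v) \<in> mSt_rel"
      by (auto simp: mSt_rel_iff stalactic_equiv_def)
    ultimately have "(map Suc u, map Suc v) \<in> mSt_rel"
      by blast
    then show "stalactic_equiv u v"
      by (simp add: mSt_rel_iff stalactic_equiv_map_inj)
  qed
  moreover have "(u, v) \<in> equational_theory mSt" if "stalactic_equiv u v" for u v
  proof -
    have "mSt_rel `` {concat (map f u)} = mSt_rel `` {concat (map f v)}"
      if f: "\<And>x. f x \<in> lists {1..}" for f
      using concat_map_in_lists[of f, OF f] stalactic_equiv_concat_map[OF \<open>stalactic_equiv u v\<close>]
      by (intro equiv_class_eq[OF mSt_rel_equiv]) (simp add: mSt_rel_iff)
    then show ?thesis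
      unfolding equational_theory_def satisfies_def mem_Collect_eq Ball_def monoid_hom_words_mSt_iff
      by auto
  qed
  ultimately show ?thesis by auto
qed


section \<open>A basis in four variables\<close>

lemma fully_invariant_congruence_iff:
  "fully_invariant_congruence R \<longleftrightarrow> equiv UNIV R \<and>
     (\<forall>a b c d. (a, b) \<in> R \<longrightarrow> (c, d) \<in> R \<longrightarrow> (a @ c, b @ d) \<in> R) \<and>
     (\<forall>f u v. (u, v) \<in> R \<longrightarrow> (concat (map f u), concat (map f v)) \<in> R)"
proof -
  have "monoid_congruence words R \<longleftrightarrow> equiv UNIV R \<and>
     (\<forall>a b c d. (a, b) \<in> R \<longrightarrow> (c, d) \<in> R \<longrightarrow> (a @ c, b @ d) \<in> R)"
    by (simp add: monoid_congruence_def free_monoid_def)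
  then show ?thesis
    unfolding fully_invariant_congruence_def Ball_def monoid_hom_words_words_iff by fast
qed

lemma fully_invariant_congruenceD:
  assumes "fully_invariant_congruence R" "(u, v) \<in> R"
  shows "(a @ concat (map f u) @ b, a @ concat (map f v) @ b) \<in> R"
proof -
  have "(w, w) \<in> R" for w
    using assms(1) by (auto simp: fully_invariant_congruence_iff equiv_def refl_on_def)
  then show ?thesis
    using assms unfolding fully_invariant_congruence_iff by blast
qed

lemma fully_invariant_congruence_stalactic_equiv:
  "fully_invariant_congruence {(u, v). stalactic_equiv u v}"
  unfolding fully_invariant_congruence_iff
proof (intro conjI)
  show "equiv UNIV {(u, v :: nat list). stalactic_equiv u v}"
    by (auto simp: equiv_def refl_on_def sym_def trans_def stalactic_equiv_def)
qed (auto intro: stalactic_equiv_append stalactic_equiv_concat_map)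

text \<open>The variables 0, 1, 2, 3 stand for x, s, y, t.\<close>

definition mSt_basis :: "identity set" where
  "mSt_basis = {([0,1,0,2,3,0], [0,1,2,0,3,0]), ([0,1,2,0,3,2], [0,1,0,2,3,2])}"

lemma mSt_basis_subset: "mSt_basis \<subseteq> {(u, v). stalactic_equiv u v}"
  by (auto simp: mSt_basis_def stalactic_equiv_def first_occurrences_def last_occurrences_def)

section \<open>Transpositions of adjacent letters modulo the basis\<close>

context
  fixes R :: "identity set"
  assumes R: "fully_invariant_congruence R" and basis: "mSt_basis \<subseteq> R"
begin

lemma congr_sym: "(u, v) \<in> R \<Longrightarrow> (v, u) \<in> R"
  using R unfolding fully_invariant_congruence_iff by (meson equivE symD)

lemma congr_trans: "(u, v) \<in> R \<Longrightarrow> (v, w) \<in> R \<Longrightarrow> (u, w) \<in> R"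
  using R unfolding fully_invariant_congruence_iff by (meson equivE transD)

lemma congr_refl: "(u, u) \<in> R"
  using R by (auto simp: fully_invariant_congruence_iff equiv_def refl_on_def)

lemma swap_same:
  assumes "x \<in> set p" "x \<in> set q"
  shows "(p @ x # y # q, p @ y # x # q) \<in> R"
proof -
  obtain p1 s t q1 where pq: "p = p1 @ x # s" "q = t @ x # q1"
    using assms by (meson split_list)
  \<comment> \<open>The possibly empty words \<open>s\<close> and \<open>t\<close> separate the
    chosen outer occurrences of \<open>x\<close> from the transposed pair; the default value
    \<open>t\<close> serves variable 3.\<close>
  show ?thesis
    using fully_invariant_congruenceD[OF R, of "[0,1,0,2,3,0]" "[0,1,2,0,3,0]" p1
        "(\<lambda>_. t)(0 := [x], 1 := s, 2 := [y])" q1] basis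
    by (auto simp: mSt_basis_def pq)
qed

lemma swap_different:
  assumes "x \<in> set p" "y \<in> set q"
  shows "(p @ y # x # q, p @ x # y # q) \<in> R"
proof -
  obtain p1 s t q1 where pq: "p = p1 @ x # s" "q = t @ y # q1"
    using assms by (meson split_list)
  show ?thesis
    using fully_invariant_congruenceD[OF R, of "[0,1,2,0,3,2]" "[0,1,0,2,3,2]" p1
        "(\<lambda>_. t)(0 := [x], 1 := s, 2 := [y])" q1] basis
    by (auto simp: mSt_basis_def pq)
qed

text \<open>If one letter occurs on both sides, \<open>swap_same\<close> applies, otherwise
  \<open>swap_different\<close>, each up to symmetry.\<close>

lemma swap:
  assumes "x \<in> set p \<or> y \<in> set p" "x \<in> set q \<or> y \<in> set q"
  shows "(p @ y # x # q, p @ x # y # q) \<in> R"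
  using assms swap_same swap_different congr_sym by blast

lemma move_to_front:
  assumes "x \<in> set c \<or> set w \<subseteq> set c" "x \<in> set q \<or> set w \<subseteq> set q"
  shows "(c @ w @ x # q, c @ x # w @ q) \<in> R"
  using assms
proof (induction w arbitrary: q rule: rev_induct)
  case Nil
  show ?case by (simp add: congr_refl)
next
  case (snoc z w)
  \<comment> \<open>\<open>x\<close> first crosses the last letter of the block, which then joins
    the right context; contexts only grow, so the hypotheses persist.\<close>
  have "((c @ w) @ z # x # q, (c @ w) @ x # z # q) \<in> R"
    by (rule swap) (use snoc.prems in auto)
  moreover have "(c @ w @ x # z # q, c @ x # w @ z # q) \<in> R"
    by (rule snoc.IH) (use snoc.prems in auto)
  ultimately show ?case
    by (auto intro: congr_trans)
qed

end

text \<open>The matched prefix \<open>c\<close> is carried along because its letters decide which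
  transpositions are allowed. For empty \<open>c\<close> and arbitrary \<open>R\<close> this is
  completeness of the basis.\<close>

lemma stalactic_equiv_in_congruence:
  assumes R: "fully_invariant_congruence R" "mSt_basis \<subseteq> R"
  assumes "stalactic_equiv (c @ u) (c @ v)"
  shows "(c @ u, c @ v) \<in> R"
  using assms(3)
proof (induction u arbitrary: c v)
  case Nil
  then have "v = []" by (simp add: stalactic_equiv_def)
  then show ?case by (simp add: congr_refl[OF R])
next
  case (Cons x u)
  have m: "mset (x # u) = mset v"
    using Cons.prems by (simp add: stalactic_equiv_def)
  then have "x \<in> set v"
    by (metis list.set_intros(1) mset_eq_setD)
  then obtain w q where v: "v = w @ x # q" and x: "x \<notin> set w"
    by (meson split_list_first)
  \<comment> \<open>Otherwise the first new letter after \<open>c\<close> would be \<open>x\<close>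
    in \<open>c @ x # u\<close> but a letter of \<open>w\<close> in \<open>c @ v\<close>.\<close>
  have first: "x \<in> set c \<or> set w \<subseteq> set c"
  proof (rule ccontr)
    assume *: "\<not> ?thesis"
    then have "x \<notin> set c" by simp
    then have "x # filter (\<lambda>a. a \<notin> set c) (filter (\<lambda>a. a \<noteq> x) (first_occurrences u)) =
        filter (\<lambda>a. a \<notin> set c) (first_occurrences w) @
        filter (\<lambda>a. a \<notin> set c) (filter (\<lambda>a. a \<notin> set w) (first_occurrences (x # q)))"
      using Cons.prems
      by (simp add: v stalactic_equiv_def first_occurrences_append first_occurrences_Cons)
    moreover have "filter (\<lambda>a. a \<notin> set c) (first_occurrences w) \<noteq> []"
      using * by (auto simp: filter_empty_conv)
    ultimately have "x \<in> set (filter (\<lambda>a. a \<notin> set c) (first_occurrences w))"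
      by (metis append_eq_Cons_conv list.set_intros(1))
    with x show False by simp
  qed
  \<comment> \<open>Otherwise this \<open>x\<close> is the only one in \<open>v\<close>, hence in
    \<open>x # u\<close>. Its last occurrence would come first in \<open>x # u\<close>, but after
    that of a letter of \<open>w\<close> in \<open>v\<close>.\<close>
  have last: "x \<in> set q \<or> set w \<subseteq> set q"
  proof (rule ccontr)
    assume *: "\<not> ?thesis"
    have "x \<notin> set u"
      using * x m by (metis Un_iff add_mset_remove_trivial mset.simps(2) mset_append
          set_append set_mset_mset union_mset_add_mset_right v)
    moreover have "set v = set (x # u)"
      using m by (metis mset_eq_setD)
    ultimately have "x # remdups u =
        filter (\<lambda>a. a \<notin> set (x # q)) (remdups w) @ x # remdups q"
      using Cons.prems *
      by (simp add: v stalactic_equiv_def last_occurrences_def remdups_append_filter[of c]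
          remdups_append_filter[of w])
    moreover have "filter (\<lambda>a. a \<notin> set (x # q)) (remdups w) \<noteq> []"
      using * x by (auto simp: filter_empty_conv)
    ultimately have "x \<in> set (filter (\<lambda>a. a \<notin> set (x # q)) (remdups w))"
      by (metis append_eq_Cons_conv list.set_intros(1))
    then show False by simp
  qed
  \<comment> \<open>Moving \<open>x\<close> modulo stalactic equivalence itself shows that the
    rearranged word is still equivalent, as the induction hypothesis requires.\<close>
  have "stalactic_equiv (c @ v) (c @ x # w @ q)"
    using move_to_front[OF fully_invariant_congruence_stalactic_equiv mSt_basis_subset first last]
    by (simp add: v)
  with Cons.prems have "stalactic_equiv ((c @ [x]) @ u) ((c @ [x]) @ w @ q)"
    by (simp add: stalactic_equiv_def)
  from Cons.IH[OF this] have "(c @ x # u, c @ x # w @ q) \<in> R"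
    by simp
  moreover have "(c @ x # w @ q, c @ v) \<in> R"
    using congr_sym[OF R move_to_front[OF R first last]] by (simp add: v)
  ultimately show ?case
    by (rule congr_trans[OF R])
qed

lemma equational_basis_mSt_basis: "equational_basis mSt mSt_basis"
  using mSt_basis_subset stalactic_equiv_in_congruence[where c = "[]"]
  by (auto simp: equational_basis_def equational_theory_mSt generated_fully_invariant_congruence_def)


section \<open>Three variables do not suffice\<close>

text \<open>With no variable erased, the first letter comes from the leading variable, which
  \<open>p\<close> and \<open>q\<close> share; if both are empty, it comes from
  \<open>b\<close>.\<close>

lemma first_occurrences_eq_heads:
  assumes "first_occurrences p = first_occurrences q" "[] \<notin> f ` set p"
    and "concat (map f p) @ b = x # u" "concat (map f q) @ b = y # v"
  shows "x = y"
proof (cases p)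
  case Nil
  then have "q = []"
    using assms(1) by (metis first_occurrences_eq_Nil_iff)
  with Nil assms show ?thesis by simp
next
  case (Cons a p')
  then obtain q' where "q = a # q'"
    using assms(1) by (cases q) (auto simp: first_occurrences_Cons)
  with Cons assms show ?thesis by (cases "f a") auto
qed

lemma common_prefix:
  assumes "w @ r = u @ x # v" "w @ r' = u @ y # v'" "x \<noteq> y"
  shows "\<exists>t. u = w @ t"
  using assms
proof (induction w arbitrary: u)
  case (Cons a w)
  then show ?case by (cases u) auto
qed simp

text \<open>Compared with \<open>xsyxty\<close>, the names \<open>x\<close> and \<open>y\<close> are
  exchanged. If \<open>s\<close> lay in \<open>a\<close> or in the image of the leading variable,
  the remainders would start with \<open>x\<close> and \<open>y\<close>, against the equal orders of
  first occurrences. This leaves only a leading variable with image \<open>[y]\<close>, followed by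
  one with image \<open>[s]\<close>.\<close>

lemma images_from_left_nonempty:
  assumes fo: "first_occurrences p = first_occurrences q"
    and p: "a @ concat (map f p) @ b = [y,s,x,y,t,x]"
    and q: "a @ concat (map f q) @ b = [y,s,y,x,t,x]"
    and d: "distinct [y,s,x,t]"
    and ne: "[] \<notin> f ` set p"
  shows "[y] \<in> f ` set p \<and> [s] \<in> f ` set p"
proof -
  \<comment> \<open>\<open>s\<close> does not recur in the rest, so neither does \<open>z\<close>;
    removing it leaves equal orders of first occurrences but different first letters.\<close>
  have skip: False
    if "first_occurrences (z # p1) = first_occurrences (z # q1)" "s \<in> set (f z)"
      "concat (map f p1) @ b = [x,y,t,x]" "concat (map f q1) @ b = [y,x,t,x]"
      "[] \<notin> f ` set p1" for z p1 q1
  proof -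
    have "z \<notin> set p1" "z \<notin> set q1"
      using that(2) d arg_cong[OF that(3), of set] arg_cong[OF that(4), of set] by auto
    then have "filter (\<lambda>a. a \<noteq> z) (first_occurrences p1) = first_occurrences p1"
      "filter (\<lambda>a. a \<noteq> z) (first_occurrences q1) = first_occurrences q1"
      by (auto simp: filter_id_conv)
    then have "first_occurrences p1 = first_occurrences q1"
      using that(1) by (simp add: first_occurrences_Cons)
    from first_occurrences_eq_heads[OF this that(5,3,4)] d show False by simp
  qed
  have "x \<noteq> y" using d by auto
  have "a = [] \<or> a = [y] \<or> a = [y,s]"
    using common_prefix[of a _ "[y,s]" x _ _ y] p q \<open>x \<noteq> y\<close>
    by (auto simp: Cons_eq_append_conv)
  moreover have "a \<noteq> [y,s]"
    using first_occurrences_eq_heads[OF fo ne, of b x "[y,t,x]" y "[x,t,x]"] p q d by auto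
  moreover have "p \<noteq> []"
  proof
    assume "p = []"
    moreover from this fo have "q = []"
      by (metis first_occurrences_eq_Nil_iff)
    ultimately show False using p q \<open>x \<noteq> y\<close> by simp
  qed
  ultimately obtain z p1 q1 where zp: "p = z # p1" "q = z # q1" and a: "a = [] \<or> a = [y]"
    using fo by (cases p; cases q) (auto simp: first_occurrences_Cons)
  have z: "f z \<noteq> []" and ne1: "[] \<notin> f ` set p1"
    using ne zp by auto
  from a show ?thesis
  proof
    assume a: "a = [y]"
    have "f z = [s]"
      using common_prefix[of "f z" _ "[s]" x _ _ y] p q z \<open>x \<noteq> y\<close>
      by (auto simp: a zp Cons_eq_append_conv)
    with p q skip[of z p1 q1] fo ne1 show ?thesis
      by (simp add: zp a)
  next
    assume a: "a = []"
    have "f z = [y] \<or> f z = [y,s]"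
    proof -
      obtain r where "[y,s] = f z @ r"
        using common_prefix[of "f z" _ "[y,s]" x _ _ y] p q \<open>x \<noteq> y\<close>
        unfolding a zp by fastforce
      with z show ?thesis
        by (cases "f z") (auto simp: Cons_eq_append_conv)
    qed
    moreover have "f z \<noteq> [y,s]"
      using p q skip[of z p1 q1] fo ne1 by (auto simp: zp a)
    ultimately have fz: "f z = [y]" by blast
    have p1: "concat (map f p1) @ b = [s,x,y,t,x]" and q1: "concat (map f q1) @ b = [s,y,x,t,x]"
      using p q by (auto simp: zp a fz)
    \<comment> \<open>If one remainder were \<open>b\<close> alone, so by length would be the other,
      though they differ.\<close>
    have "p1 \<noteq> []" "q1 \<noteq> []"
      using p1 q1 d arg_cong[OF p1, of length] arg_cong[OF q1, of length]
      by (auto simp: length_concat Cons_eq_append_conv)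
    then obtain z1 p2 z2 q2 where z12: "p1 = z1 # p2" "q1 = z2 # q2"
      by (auto simp: neq_Nil_conv)
    have "[] \<notin> f ` set q1"
      using ne fo zp by (metis list.set_intros(2) set_first_occurrences image_iff)
    then have hd: "f z1 \<noteq> []" "f z2 \<noteq> []"
      using ne1 z12 by auto
    \<comment> \<open>Both images start with \<open>s\<close>, not \<open>y\<close>, so
      \<open>z1\<close> and \<open>z2\<close> are each the second variable to appear.\<close>
    have "z1 \<noteq> z" "z2 \<noteq> z"
      using p1 q1 d by (auto simp: z12 fz)
    then have "z1 = z2"
      using fo by (simp add: zp z12 first_occurrences_Cons)
    then have "f z1 = [s]"
      using common_prefix[of "f z1" _ "[s]" x _ _ y] p1 q1 hd \<open>x \<noteq> y\<close>
      by (auto simp: z12 Cons_eq_append_conv)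
    then show ?thesis
      using fz by (auto simp: zp z12)
  qed
qed

lemma images_from_left:
  assumes fo: "first_occurrences p = first_occurrences q"
    and p: "a @ concat (map f p) @ b = [y,s,x,y,t,x]"
    and q: "a @ concat (map f q) @ b = [y,s,y,x,t,x]"
    and d: "distinct [y,s,x,t]"
  shows "[y] \<in> f ` set p \<and> [s] \<in> f ` set p"
proof -
  \<comment> \<open>Deleting the variables with empty image changes neither the image words nor the
    agreement of the orders.\<close>
  define g where "g = filter (\<lambda>z. f z \<noteq> [])"
  have "concat (map f (g w)) = concat (map f w)" for w
    by (induction w) (auto simp: g_def)
  moreover have "first_occurrences (g p) = first_occurrences (g q)"
    using fo by (simp add: g_def first_occurrences_filter)
  moreover have "[] \<notin> f ` set (g p)"
    by (auto simp: g_def)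
  ultimately have "[y] \<in> f ` set (g p) \<and> [s] \<in> f ` set (g p)"
    using images_from_left_nonempty[of "g p" "g q" a f b] p q d by simp
  then show ?thesis by (auto simp: g_def)
qed

lemma four_variables:
  assumes pq: "stalactic_equiv p q"
    and p: "a @ concat (map f p) @ b = [y,s,x,y,t,x]"
    and q: "a @ concat (map f q) @ b = [y,s,y,x,t,x]"
    and d: "distinct [y,s,x,t]"
  shows "4 \<le> card (set p)"
proof -
  have r: "rev (concat (map f w)) = concat (map (rev \<circ> f) (rev w))" for w
    by (simp add: rev_concat rev_map)
  have "[y] \<in> f ` set p \<and> [s] \<in> f ` set p"
    using pq by (intro images_from_left[OF _ p q d]) (simp add: stalactic_equiv_def)
  \<comment> \<open>Reversal turns last occurrences into first ones and yields a pair of the same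
    shape, with \<open>x\<close>, \<open>y\<close> and \<open>s\<close>, \<open>t\<close>
    exchanged.\<close>
  moreover have "[x] \<in> (rev \<circ> f) ` set (rev p) \<and> [t] \<in> (rev \<circ> f) ` set (rev p)"
  proof (rule images_from_left)
    show "first_occurrences (rev p) = first_occurrences (rev q)"
      using pq by (simp add: stalactic_equiv_def first_occurrences_def last_occurrences_def)
    show "rev b @ concat (map (rev \<circ> f) (rev p)) @ rev a = [x,t,y,x,s,y]"
      using arg_cong[OF p, of rev] by (simp add: r)
    show "rev b @ concat (map (rev \<circ> f) (rev q)) @ rev a = [x,t,x,y,s,y]"
      using arg_cong[OF q, of rev] by (simp add: r)
    show "distinct [x,t,y,s]" using d by auto
  qed
  ultimately have "{[y],[s],[x],[t]} \<subseteq> f ` set p"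
    by (simp add: image_iff)
  then have "card {[y],[s],[x],[t]} \<le> card (f ` set p)"
    by (intro card_mono) auto
  also have "\<dots> \<le> card (set p)"
    by (intro card_image_le) auto
  finally show ?thesis using d by simp
qed

section \<open>The class of \<open>[0,1,2,0,3,2]\<close> and a congruence isolating this
  word\<close>

lemma stalactic_class:
  assumes "stalactic_equiv [0,1,2,0,3,2::nat] v"
  shows "v = [0,1,2,0,3,2] \<or> v = [0,1,0,2,3,2]"
proof -
  note * = assms[unfolded stalactic_equiv_def]
  have "length v = 6"
    using arg_cong[OF conjunct1[OF *], of size] by simp
  then obtain a b c d e g where v: "v = [a,b,c,d,e,g]"
    by (auto simp: eval_nat_numeral length_Suc_conv)
  have "a = 0"
    using arg_cong[OF conjunct1[OF conjunct2[OF *]], of hd]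
    by (simp add: v first_occurrences_Cons)
  have "last (last_occurrences v) = last v"
    using remdups_filter_last[of "\<lambda>_. True" v] by (simp add: last_occurrences_def)
  moreover have "last_occurrences v = [1,0,3,2]"
    using conjunct2[OF conjunct2[OF *]] by (simp add: last_occurrences_def)
  ultimately have "last v = 2" by simp
  then have "g = 2" by (simp add: v)
  have m: "mset [b,c,d,e] = mset [0,1,2,3]"
    using conjunct1[OF *] by (simp add: v \<open>a = 0\<close> \<open>g = 2\<close> add_mset_commute)
  then have s: "set [b,c,d,e] = set [0,1,2,3]"
    by (rule mset_eq_setD)
  have d: "distinct [b,c,d,e]"
    using mset_eq_imp_distinct_iff[OF m] by simp
  define L where "L = [b,c,d,e]"
  have v': "v = 0 # L @ [2]"
    by (simp add: v L_def \<open>a = 0\<close> \<open>g = 2\<close>)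
  have L: "0 \<in> set L" "2 \<in> set L" "distinct L"
    using s d by (simp_all only: L_def) simp_all
  then have "first_occurrences v = 0 # filter (\<lambda>a. a \<noteq> 0) L"
    by (simp add: v' first_occurrences_Cons first_occurrences_append)
      (simp add: first_occurrences_def distinct_remdups_id)
  moreover have "last_occurrences v = filter (\<lambda>a. a \<noteq> 2) L @ [2]"
    using L by (simp add: v' last_occurrences_def remdups_append_filter distinct_remdups_id)
  \<comment> \<open>The middle is a permutation of 0, 1, 2, 3. Both 0 and 2 must stand between 1 and
    3, so only their relative order is free.\<close>
  ultimately have "filter (\<lambda>a. a \<noteq> 0) [b,c,d,e] = [1,2,3]" "filter (\<lambda>a. a \<noteq> 2) [b,c,d,e] = [1,0,3]"
    using * by (simp_all add: L_def first_occurrences_def last_occurrences_def)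
  then show ?thesis
    by (auto simp: v' L_def split: if_splits)
qed

text \<open>The largest fully invariant congruence for which \<open>{w}\<close> is a union of classes.\<close>

definition saturating_congruence :: "nat list \<Rightarrow> identity set" where
  "saturating_congruence w = {(u, v). \<forall>a b f.
     a @ concat (map f u) @ b = w \<longleftrightarrow> a @ concat (map f v) @ b = w}"

lemma fully_invariant_congruence_saturating: "fully_invariant_congruence (saturating_congruence w)"
  unfolding fully_invariant_congruence_iff
proof (intro conjI allI impI)
  show "equiv UNIV (saturating_congruence w)"
    by (auto simp: saturating_congruence_def equiv_def refl_on_def sym_def trans_def)
next
  fix a b c d assume "(a, b) \<in> saturating_congruence w" "(c, d) \<in> saturating_congruence w"
  \<comment> \<open>Each factor is replaced in turn, the other being absorbed into the
    context.\<close>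
  then show "(a @ c, b @ d) \<in> saturating_congruence w"
    unfolding saturating_congruence_def by clarsimp (metis append.assoc)
next
  fix f :: "nat \<Rightarrow> nat list" and u v :: "nat list"
  assume *: "(u, v) \<in> saturating_congruence w"
  have "concat (map g (concat (map f w))) = concat (map (\<lambda>x. concat (map g (f x))) w)"
    for g :: "nat \<Rightarrow> nat list" and w
    by (induction w) auto
  with * show "(concat (map f u), concat (map f v)) \<in> saturating_congruence w"
    by (simp add: saturating_congruence_def)
qed

text \<open>Applying such an identity keeps \<open>[0,1,2,0,3,2]\<close> in its two-element class,
  and reaching the other element takes four variables.\<close>

lemma few_variables_saturating:
  assumes "stalactic_equiv p q" "card (variables (p, q)) < 4"
  shows "(p, q) \<in> saturating_congruence [0,1,2,0,3,2]"
proof -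
  have *: "a @ concat (map f v) @ b = [0,1,2,0,3,2]"
    if uv: "stalactic_equiv u v" "card (set u) < 4"
      and u: "a @ concat (map f u) @ b = [0,1,2,0,3,2]" for u v a b and f :: "nat \<Rightarrow> nat list"
  proof -
    have "stalactic_equiv (a @ concat (map f u) @ b) (a @ concat (map f v) @ b)"
      using fully_invariant_congruenceD[OF fully_invariant_congruence_stalactic_equiv] uv(1) by auto
    then have "a @ concat (map f v) @ b = [0,1,2,0,3,2] \<or> a @ concat (map f v) @ b = [0,1,0,2,3,2]"
      using stalactic_class unfolding u by blast
    then show ?thesis
      using four_variables[OF uv(1) u] uv(2) by force
  qed
  have "set p = set q"
    using assms(1) by (auto simp: stalactic_equiv_def dest: mset_eq_setD)
  then show ?thesis
    using * assms stalactic_equiv_sym[OF assms(1)]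
    unfolding saturating_congruence_def variables_def by fastforce
qed

lemma equational_basis_needs_four_variables:
  assumes "equational_basis mSt B" "\<forall>e\<in>B. card (variables e) \<le> r"
  shows "4 \<le> r"
proof (rule ccontr)
  assume "\<not> 4 \<le> r"
  let ?w = "[0,1,2,0,3,2::nat]" and ?w' = "[0,1,0,2,3,2::nat]"
  have "B \<subseteq> saturating_congruence ?w"
    using assms \<open>\<not> 4 \<le> r\<close> few_variables_saturating
    by (fastforce simp: equational_basis_def equational_theory_mSt)
  then have "generated_fully_invariant_congruence B \<subseteq> saturating_congruence ?w"
    using fully_invariant_congruence_saturating
    unfolding generated_fully_invariant_congruence_def by blast
  moreover have "(?w, ?w') \<in> equational_theory mSt"
    using mSt_basis_subset by (auto simp: equational_theory_mSt mSt_basis_def)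
  ultimately have "(?w, ?w') \<in> saturating_congruence ?w"
    using assms(1) by (auto simp: equational_basis_def)
  then have "\<forall>a b f. a @ concat (map f ?w) @ b = ?w \<longleftrightarrow> a @ concat (map f ?w') @ b = ?w"
    unfolding saturating_congruence_def mem_Collect_eq prod.case .
  \<comment> \<open>The identity substitution with empty contexts would make \<open>?w'\<close>
    equal to \<open>?w\<close>.\<close>
  from this[rule_format, of "[]" "\<lambda>x. [x]" "[]"] show False by simp
qed

theorem corollary7p10: "axiomatic_rank mSt = 4"
proof -
  have "\<forall>e\<in>mSt_basis. card (variables e) \<le> 4"
    by (auto simp: mSt_basis_def variables_def card_insert_if)
  then have "axiomatic_rank mSt \<le> enat 4"
    using equational_basis_mSt_basis unfolding axiomatic_rank_def by (intro Inf_lower) blast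
  moreover have "enat 4 \<le> axiomatic_rank mSt"
    using equational_basis_needs_four_variables unfolding axiomatic_rank_def
    by (intro Inf_greatest) auto
  ultimately show ?thesis
    by (simp add: numeral_eq_enat)
qed

end
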